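(* Let $G$ be a simple graph of order $N$ and size $s>0$ with $\operatorname{FR}_{\min}(G)=\mathcal E(G)/\sqrt{2s}$, and let $\sigma$ be a vertex labeling attaining equality, that is, $\operatorname{FR}(A_\sigma)=\mathcal E(G)/\sqrt{2s}$. Then $(G,\sigma)$ is walk-circulant at length $2q$ for every positive integer $q$.
   Context: Graphs are finite, simple and undirected. A vertex labeling of a graph $G=(V,E)$ of order $N=|V|$ is a bijection $\sigma:V\to\mathbb Z_N=\mathbb Z/N\mathbb Z$. The adjacency matrix under $\sigma$ is the $N\times N$ matrix $A_\sigma$, indexed by $\mathbb Z_N\times\mathbb Z_N$, with $(A_\sigma)_{x,y}=1$ if the vertices labeled $x$ and $y$ are adjacent and $0$ otherwise. $F$ is the unitary Fourier matrix $F_{mx}=\frac1{\sqrt N}e^{-2\pi i mx/N}$. The Fourier ratio of a nonzero $N\times N$ matrix $M$ is $\operatorname{FR}(M)=\|FMF\|_1/\|FMF\|_2$, where $\|\cdot\|_1$ is the entrywise $\ell^1$-norm and $\|\cdot\|_2$ the Frobenius norm. The edge complexity is $\operatorname{FR}_{\min}(G)=\min_\sigma\operatorname{FR}(A_\sigma)$, the minimum over all vertex labelings. The graph energy $\mathcal E(G)$ is the sum of the absolute values of the adjacency eigenvalues counted with multiplicity. For a labeling $\sigma$, let $p_\ell(x,y)$ denote the number of walks of length $\ell$ from the vertex labeled $x$ to the vertex labeled $y$. For an integer $q\ge0$, $(G,\sigma)$ is called walk-circulant at length $q$ if $p_q(x,y)=p_q(x+1,y+1)$ for all $x,y\in\mathbb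 Z_N$. *)

theory Defs
  imports
    Complex_Main
    "Graph_Theory.Pair_Digraph"
    "Jordan_Normal_Form.Char_Poly"
    "HOL-Computational_Algebra.Fundamental_Theorem_Algebra"
begin

text \<open>
  A finite simple undirected graph is a \<^locale>\<open>pair_graph\<close>: a finite loop-free digraph without
  parallel arcs whose arc relation is symmetric. Each undirected edge \<open>{u, v}\<close> is thus represented
  by the two arcs \<open>(u, v)\<close> and \<open>(v, u)\<close>.
\<close>

definition graph_order :: "'a pair_pre_digraph \<Rightarrow> nat" where
  "graph_order G = card (pverts G)"

definition graph_size :: "'a pair_pre_digraph \<Rightarrow> nat" where
  "graph_size G = card {{u, v} | u v. (u, v) \<in> parcs G}"


section \<open>Labelings and adjacency matrices\<close>

text \<open>
  The group of integers modulo \<open>N\<close> is represented by \<open>{..<N}\<close> with addition modulo \<open>N\<close>. The values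
  of a labeling outside the vertex set are irrelevant: everything below depends on \<open>\<sigma>\<close> only through
  \<open>label_vertex G \<sigma> x\<close> for \<open>x < N\<close>, the vertex with label \<open>x\<close>.
\<close>

definition vertex_labeling :: "'a pair_pre_digraph \<Rightarrow> ('a \<Rightarrow> nat) \<Rightarrow> bool" where
  "vertex_labeling G \<sigma> \<longleftrightarrow> bij_betw \<sigma> (pverts G) {..<graph_order G}"

definition label_vertex :: "'a pair_pre_digraph \<Rightarrow> ('a \<Rightarrow> nat) \<Rightarrow> nat \<Rightarrow> 'a" where
  "label_vertex G \<sigma> x = inv_into (pverts G) \<sigma> x"

definition adj_matrix :: "'a pair_pre_digraph \<Rightarrow> ('a \<Rightarrow> nat) \<Rightarrow> complex mat" where
  "adj_matrix G \<sigma> = mat (graph_order G) (graph_order G)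
     (\<lambda>(x, y). if (label_vertex G \<sigma> x, label_vertex G \<sigma> y) \<in> parcs G then 1 else 0)"


section \<open>Fourier ratio and edge complexity\<close>

definition fourier_matrix :: "nat \<Rightarrow> complex mat" where
  "fourier_matrix N = mat N N (\<lambda>(m, x).
     1 / complex_of_real (sqrt (real N)) * exp (- 2 * complex_of_real pi * \<i> * of_nat m * of_nat x / of_nat N))"

definition entry_l1_norm :: "complex mat \<Rightarrow> real" where
  "entry_l1_norm M = (\<Sum>i<dim_row M. \<Sum>j<dim_col M. cmod (M $$ (i, j)))"

definition frobenius_norm :: "complex mat \<Rightarrow> real" where
  "frobenius_norm M = sqrt (\<Sum>i<dim_row M. \<Sum>j<dim_col M. (cmod (M $$ (i, j)))\<^sup>2)"

text \<open>Meant for nonzero square matrices; note that the right factor is \<open>F\<close>, not its adjoint.\<close>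

definition fourier_ratio :: "complex mat \<Rightarrow> real" where
  "fourier_ratio M = (let F = fourier_matrix (dim_row M) in
     entry_l1_norm (F * M * F) / frobenius_norm (F * M * F))"

definition edge_complexity :: "'a pair_pre_digraph \<Rightarrow> real" where
  "edge_complexity G = Min {fourier_ratio (adj_matrix G \<sigma>) | \<sigma>. vertex_labeling G \<sigma>}"


section \<open>Graph energy\<close>

text \<open>
  The multiset of roots of the characteristic polynomial over the complex numbers is the multiset
  of all eigenvalues, with multiplicity.
\<close>

definition matrix_energy :: "complex mat \<Rightarrow> real" where
  "matrix_energy M = (\<Sum>z\<in>#proots (char_poly M). cmod z)"

text \<open>
  The adjacency eigenvalues do not depend on the labeling used to write down the adjacency matrix;
  see \<open>graph_energy_eq\<close> below.
\<close>

definition graph_energy :: "'a pair_pre_digraph \<Rightarrow> real" where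
  "graph_energy G = matrix_energy (adj_matrix G (SOME \<sigma>. vertex_labeling G \<sigma>))"


section \<open>Walks\<close>

text \<open>A walk is the list of its arcs, so its length is the length of the list.\<close>

definition walk_count :: "'a pair_pre_digraph \<Rightarrow> ('a \<Rightarrow> nat) \<Rightarrow> nat \<Rightarrow> nat \<Rightarrow> nat \<Rightarrow> nat" where
  "walk_count G \<sigma> l x y = card {p. pre_digraph.awalk (with_proj G)
     (label_vertex G \<sigma> x) p (label_vertex G \<sigma> y) \<and> length p = l}"

definition walk_circulant_at :: "'a pair_pre_digraph \<Rightarrow> ('a \<Rightarrow> nat) \<Rightarrow> nat \<Rightarrow> bool" where
  "walk_circulant_at G \<sigma> q \<longleftrightarrow> (let N = graph_order G in
     \<forall>x<N. \<forall>y<N. walk_count G \<sigma> q x y = walk_count G \<sigma> q ((x + 1) mod N) ((y + 1) mod N))"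


section \<open>Well-definedness\<close>

lemma ex_vertex_labeling:
  assumes "finite (pverts G)"
  shows "\<exists>\<sigma>. vertex_labeling G \<sigma>"
  using ex_bij_betw_finite_nat[OF assms]
  by (auto simp: vertex_labeling_def graph_order_def atLeast0LessThan)

lemma finite_fourier_ratios: "finite {fourier_ratio (adj_matrix G \<sigma>) | \<sigma>. vertex_labeling G \<sigma>}"
proof -
  let ?N = "graph_order G"
  let ?I = "{..<?N} \<times> {..<?N}"
  let ?m = "\<lambda>S. mat ?N ?N (\<lambda>p. if p \<in> S then 1 else 0 :: complex)"
  have "adj_matrix G \<sigma> \<in> ?m ` Pow ?I" for \<sigma>
  proof (rule image_eqI)
    show "adj_matrix G \<sigma> = ?m {(x, y) \<in> ?I. (label_vertex G \<sigma> x, label_vertex G \<sigma> y) \<in> parcs G}"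
      by (intro eq_matI) (auto simp: adj_matrix_def)
  qed auto
  then have "{fourier_ratio (adj_matrix G \<sigma>) | \<sigma>. vertex_labeling G \<sigma>} \<subseteq> fourier_ratio ` ?m ` Pow ?I"
    by blast
  then show ?thesis
    by (rule finite_subset) auto
qed

lemma similar_adj_matrix:
  assumes s: "vertex_labeling G \<sigma>" and t: "vertex_labeling G \<tau>"
  shows "similar_mat (adj_matrix G \<tau>) (adj_matrix G \<sigma>)"
proof -
  let ?N = "graph_order G" and ?A = "adj_matrix G \<sigma>"
  define \<pi> where "\<pi> x = \<sigma> (label_vertex G \<tau> x)" for x
  have bij: "bij_betw \<pi> {..<?N} {..<?N}"
    using bij_betw_trans[OF bij_betw_inv_into[OF t[unfolded vertex_labeling_def]] s[unfolded vertex_labeling_def]]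
    by (simp add: \<pi>_def[abs_def] label_vertex_def comp_def)
  have lt: "\<pi> x < ?N" if "x < ?N" for x
    using bij_betwE[OF bij] that by auto
  have inj: "\<pi> x = \<pi> y \<longleftrightarrow> x = y" if "x < ?N" "y < ?N" for x y
    using bij that by (auto simp: bij_betw_def inj_on_eq_iff)
  have lv: "label_vertex G \<sigma> (\<pi> x) = label_vertex G \<tau> x" if "x < ?N" for x
  proof -
    have "label_vertex G \<tau> x \<in> pverts G"
      using t that unfolding vertex_labeling_def label_vertex_def
      by (metis bij_betw_imp_surj_on inv_into_into lessThan_iff)
    then show ?thesis
      using s unfolding vertex_labeling_def label_vertex_def \<pi>_def
      by (metis bij_betw_imp_inj_on inv_into_f_f)
  qed
  define P :: "complex mat" where "P = mat ?N ?N (\<lambda>(i, j). if j = \<pi> i then 1 else 0)"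
  let ?Q = "transpose_mat P"
  have P: "P \<in> carrier_mat ?N ?N" and A: "?A \<in> carrier_mat ?N ?N"
    by (auto simp: P_def adj_matrix_def)
  have Pm: "(P * M) $$ (i, j) = M $$ (\<pi> i, j)"
    if "M \<in> carrier_mat ?N ?N" "i < ?N" "j < ?N" for M i j
    using that lt[of i]
    by (auto simp: P_def scalar_prod_def if_distrib[of "\<lambda>x. x * _"] sum.delta cong: if_cong)
  have mQ: "(M * ?Q) $$ (i, j) = M $$ (i, \<pi> j)"
    if "M \<in> carrier_mat ?N ?N" "i < ?N" "j < ?N" for M i j
    using that lt[of j]
    by (auto simp: P_def scalar_prod_def if_distrib[of "\<lambda>x. _ * x"] sum.delta cong: if_cong)
  have PQ: "P * ?Q = 1\<^sub>m ?N"
  proof (rule eq_matI, goal_cases)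
    case (1 i j)
    then have ij: "i < ?N" "j < ?N" by auto
    show ?case
      unfolding mQ[OF P ij] using ij lt[of j] by (auto simp: P_def inj)
  qed (use P in auto)
  have QP: "?Q * P = 1\<^sub>m ?N"
    using mat_mult_left_right_inverse[OF P _ PQ] P by auto
  have "adj_matrix G \<tau> = P * ?A * ?Q"
  proof (rule eq_matI, goal_cases)
    case (1 i j)
    then have ij: "i < ?N" "j < ?N" using P by auto
    have "(P * ?A * ?Q) $$ (i, j) = ?A $$ (\<pi> i, \<pi> j)"
      using mQ[OF mult_carrier_mat[OF P A] ij] Pm[OF A ij(1) lt[OF ij(2)]] by simp
    also have "\<dots> = adj_matrix G \<tau> $$ (i, j)"
      using ij lt by (auto simp: adj_matrix_def lv)
    finally show ?case by simp
  qed (use P in \<open>auto simp: adj_matrix_def\<close>)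
  then have "similar_mat_wit (adj_matrix G \<tau>) ?A P ?Q"
    using P A PQ QP by (intro similar_mat_witI[of _ _ ?N]) (auto simp: adj_matrix_def)
  then show ?thesis
    unfolding similar_mat_def by blast
qed

lemma graph_energy_eq:
  assumes "vertex_labeling G \<sigma>"
  shows "graph_energy G = matrix_energy (adj_matrix G \<sigma>)"
proof -
  have "vertex_labeling G (SOME \<sigma>. vertex_labeling G \<sigma>)"
    using someI[of "vertex_labeling G", OF assms] .
  from char_poly_similar[OF similar_adj_matrix[OF assms this]] show ?thesis
    by (simp add: graph_energy_def matrix_energy_def)
qed

end

theory Submission
  imports Defs "Jordan_Normal_Form.Schur_Decomposition"
begin

text \<open>
  Write \<open>A\<close> for the adjacency matrix and \<open>B = F A F\<close>. With the Hermitian symmetry \<open>W = sgn A\<close> we have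
  \<open>tr (W A) = E(G)\<close>, so the unitary matrix \<open>V = F\<^sup>* W F\<^sup>*\<close> satisfies \<open>tr (V B) = E(G)\<close>. The entries of
  \<open>V\<close> have modulus at most 1 and the Frobenius norm of \<open>B\<close> is \<open>sqrt (2 s)\<close>, hence
  \<open>E(G) \<le> \<parallel>B\<parallel>\<^sub>1\<close>, and equality forces \<open>|V\<^sub>j\<^sub>i| = 1\<close> wherever \<open>B\<^sub>i\<^sub>j \<noteq> 0\<close>. As the rows of \<open>V\<close> are unit
  vectors, each column of \<open>B\<close> has at most one nonzero entry, so \<open>B B\<^sup>* = F A\<^sup>2 F\<^sup>*\<close> is diagonal.
  Therefore \<open>A\<^sup>2\<close> and all its powers, which count the walks of even length, are circulant.
\<close>

section \<open>Adjoint and trace\<close>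

definition mat_trace :: "'a::comm_monoid_add mat \<Rightarrow> 'a" where
  "mat_trace M = (\<Sum>i<dim_row M. M $$ (i, i))"

lemma index_mult_mat_sum:
  assumes "A \<in> carrier_mat n m" "B \<in> carrier_mat m k" "i < n" "j < k"
  shows "(A * B) $$ (i, j) = (\<Sum>l<m. A $$ (i, l) * B $$ (l, j))"
  using assms by (auto simp: scalar_prod_def atLeast0LessThan)

lemma dim_mat_adjoint [simp]:
  "dim_row (mat_adjoint A) = dim_col A" "dim_col (mat_adjoint A) = dim_row A"
  by (simp_all add: mat_adjoint_def)

lemma mat_adjoint_carrier [simp]:
  "A \<in> carrier_mat n m \<Longrightarrow> mat_adjoint A \<in> carrier_mat m n"
  by (metis carrier_matD carrier_matI dim_mat_adjoint)

lemma index_mat_adjoint [simp]: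
  "i < dim_col A \<Longrightarrow> j < dim_row A \<Longrightarrow> mat_adjoint A $$ (i, j) = conjugate (A $$ (j, i))"
  by (simp add: mat_adjoint_def mat_of_rows_def)

lemma mat_adjoint_mult:
  fixes A B :: "complex mat"
  assumes "A \<in> carrier_mat n m" "B \<in> carrier_mat m k"
  shows "mat_adjoint (A * B) = mat_adjoint B * mat_adjoint A"
proof (rule eq_matI, goal_cases)
  case (1 i j)
  then have ij: "i < k" "j < n" using assms by auto
  have "mat_adjoint (A * B) $$ (i, j) = cnj (\<Sum>l<m. A $$ (j, l) * B $$ (l, i))"
    using assms ij by (simp add: index_mult_mat_sum[OF assms] del: index_mult_mat(1))
  also have "\<dots> = (\<Sum>l<m. mat_adjoint B $$ (i, l) * mat_adjoint A $$ (l, j))"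
    using assms ij by (simp add: mult.commute)
  finally show ?case
    using assms ij by (simp add: index_mult_mat_sum[of _ k m _ n] del: index_mult_mat(1))
qed (use assms in auto)

lemma mat_adjoint_adjoint [simp]: "mat_adjoint (mat_adjoint A) = (A :: complex mat)"
  by (rule eq_matI) auto

lemma mat_adjoint_add:
  fixes A B :: "complex mat"
  assumes "A \<in> carrier_mat n m" "B \<in> carrier_mat n m"
  shows "mat_adjoint (A + B) = mat_adjoint A + mat_adjoint B"
  using assms by (intro eq_matI) auto

lemma mat_adjoint_smult: "mat_adjoint (c \<cdot>\<^sub>m A) = cnj c \<cdot>\<^sub>m mat_adjoint (A :: complex mat)"
  by (rule eq_matI) auto

lemma mat_adjoint_one [simp]: "mat_adjoint (1\<^sub>m n) = (1\<^sub>m n :: complex mat)"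
  by (rule eq_matI) auto

lemma mat_trace_mult_eq:
  assumes "A \<in> carrier_mat n m" "B \<in> carrier_mat m n"
  shows "mat_trace (A * B) = (\<Sum>i<n. \<Sum>j<m. A $$ (i, j) * B $$ (j, i))"
  using assms by (simp add: mat_trace_def index_mult_mat_sum[OF assms] del: index_mult_mat(1))

lemma mat_trace_mult_commute:
  fixes A B :: "'a::comm_semiring_0 mat"
  assumes "A \<in> carrier_mat n m" "B \<in> carrier_mat m n"
  shows "mat_trace (A * B) = mat_trace (B * A)"
  by (subst mat_trace_mult_eq[OF assms], subst mat_trace_mult_eq[OF assms(2,1)], subst sum.swap)
    (simp add: mult.commute)

text \<open>Cyclicity of the trace moves \<open>Q\<close> to the front, where it cancels against
  \<open>P\<close>.\<close>

lemma mat_trace_similar: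
  fixes A :: "'a::comm_semiring_1 mat"
  assumes "similar_mat_wit A B P Q"
  shows "mat_trace A = mat_trace B"
proof -
  obtain n where n: "P * Q = 1\<^sub>m n" "Q * P = 1\<^sub>m n" "A = P * B * Q"
    "B \<in> carrier_mat n n" "P \<in> carrier_mat n n" "Q \<in> carrier_mat n n"
    using similar_mat_witD[OF refl assms] by blast
  have "mat_trace A = mat_trace (Q * (P * B))"
    unfolding n(3) using n(4-) by (intro mat_trace_mult_commute[of _ n n]) auto
  also have "Q * (P * B) = B"
    using n assoc_mult_mat[of Q n n P n B n] by simp
  finally show ?thesis .
qed

lemma mat_trace_mult_adjoint:
  fixes M :: "complex mat"
  assumes "M \<in> carrier_mat n m"
  shows "mat_trace (M * mat_adjoint M) = of_real (\<Sum>i<n. \<Sum>j<m. (cmod (M $$ (i, j)))\<^sup>2)"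
  using assms by (subst mat_trace_mult_eq) (auto simp flip: complex_norm_square)

lemma frobenius_norm_eq_trace:
  "frobenius_norm M = sqrt (Re (mat_trace (M * mat_adjoint M)))"
  unfolding frobenius_norm_def by (subst mat_trace_mult_adjoint[OF carrier_matI]) auto

text \<open>For Hermitian \<open>H\<close> the trace of \<open>H * H\<close> is the sum of the
  squared moduli of all entries. This stands in for diagonalisability: trace information about a
  triangular form is enough to conclude that a Hermitian matrix vanishes.\<close>

lemma hermitian_trace_square_zero:
  fixes H :: "complex mat"
  assumes "H \<in> carrier_mat n n" "mat_adjoint H = H" "mat_trace (H * H) = 0"
  shows "H = 0\<^sub>m n n"
proof -
  have "(\<Sum>i<n. \<Sum>j<n. (cmod (H $$ (i, j)))\<^sup>2) = 0"
    using mat_trace_mult_adjoint[OF assms(1)] assms(2,3) by (metis of_real_eq_0_iff)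
  then have "\<forall>i<n. \<forall>j<n. H $$ (i, j) = 0"
    by (simp add: sum_nonneg_eq_0_iff sum_nonneg)
  then show ?thesis
    using assms(1) by (intro eq_matI) auto
qed


section \<open>A symmetry realising the energy\<close>

text \<open>In the product sum for position \<open>(i, j)\<close> only indices \<open>l\<close>
  between \<open>i\<close> and \<open>j\<close> contribute. Below the diagonal there are none, and
  on it only \<open>l = i\<close> remains.\<close>

lemma upper_triangular_mult_diag:
  fixes A B :: "'a::semiring_0 mat"
  assumes A: "A \<in> carrier_mat n n" and B: "B \<in> carrier_mat n n"
    and utA: "upper_triangular A" and utB: "upper_triangular B"
  shows "upper_triangular (A * B)"
    and "\<And>i. i < n \<Longrightarrow> (A * B) $$ (i, i) = A $$ (i, i) * B $$ (i, i)"
proof -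
  have 0: "A $$ (i, l) * B $$ (l, j) = 0" if "i < n" "l < n" "l < i \<or> j < l" for i j l
    using that upper_triangularD[OF utA, of l i] upper_triangularD[OF utB, of j l] A B by auto
  show "upper_triangular (A * B)"
  proof
    fix i j assume "j < i" "i < dim_row (A * B)"
    then show "(A * B) $$ (i, j) = 0"
      using A B by (subst index_mult_mat_sum[OF A B]) (auto intro!: sum.neutral 0)
  qed
  show "(A * B) $$ (i, i) = A $$ (i, i) * B $$ (i, i)" if i: "i < n" for i
  proof -
    have "(A * B) $$ (i, i) = (\<Sum>l<n. A $$ (i, l) * B $$ (l, i))"
      by (rule index_mult_mat_sum[OF A B i i])
    also have "\<dots> = (\<Sum>l\<in>{i}. A $$ (i, l) * B $$ (l, i))"
      using i by (intro sum.mono_neutral_right) (auto intro: 0)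
    finally show ?thesis by simp
  qed
qed

text \<open>For an eigenvector \<open>v\<close> the quadratic form \<open>s\<close> equals
  \<open>k\<close> times the squared norm \<open>r\<close> of \<open>v\<close>. The form is its own
  conjugate because \<open>A\<close> is Hermitian, and \<open>r\<close> is a nonzero real.\<close>

lemma hermitian_eigenvalue_real:
  fixes A :: "complex mat"
  assumes A: "A \<in> carrier_mat n n" and H: "mat_adjoint A = A" and e: "eigenvalue A k"
  shows "k \<in> \<real>"
proof -
  obtain v where v: "v \<in> carrier_vec n" "v \<noteq> 0\<^sub>v n" and Av: "A *\<^sub>v v = k \<cdot>\<^sub>v v"
    using e A by (auto simp: eigenvalue_def eigenvector_def)
  define s where "s = (\<Sum>i<n. \<Sum>j<n. cnj (v $ i) * A $$ (i, j) * v $ j)"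
  define r where "r = (\<Sum>i<n. (cmod (v $ i))\<^sup>2)"
  have Av': "(\<Sum>j<n. A $$ (i, j) * v $ j) = k * v $ i" if "i < n" for i
    using arg_cong[OF Av, of "\<lambda>w. w $ i"] that A v(1)
    by (simp add: scalar_prod_def atLeast0LessThan)
  have "s = (\<Sum>i<n. cnj (v $ i) * (\<Sum>j<n. A $$ (i, j) * v $ j))"
    by (simp add: s_def sum_distrib_left mult.assoc)
  also have "\<dots> = k * of_real r"
    unfolding r_def of_real_sum sum_distrib_left[of k]
  proof (intro sum.cong refl)
    fix i assume "i \<in> {..<n}"
    then have "cnj (v $ i) * (\<Sum>j<n. A $$ (i, j) * v $ j) = cnj (v $ i) * (k * v $ i)"
      using Av' by simp
    also have "\<dots> = k * of_real ((cmod (v $ i))\<^sup>2)"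
      unfolding complex_norm_square by (simp only: mult_ac)
    finally show "cnj (v $ i) * (\<Sum>j<n. A $$ (i, j) * v $ j) = k * of_real ((cmod (v $ i))\<^sup>2)" .
  qed
  finally have s: "s = k * of_real r" .
  have sym: "cnj (A $$ (i, j)) = A $$ (j, i)" if "i < n" "j < n" for i j
    using index_mat_adjoint[of j A i] that A H by simp
  have "cnj s = (\<Sum>i<n. \<Sum>j<n. cnj (v $ j) * A $$ (j, i) * v $ i)"
    unfolding s_def by (simp add: sym mult_ac)
  also have "\<dots> = s"
    unfolding s_def by (rule sum.swap)
  finally have "cnj k * of_real r = k * of_real r"
    using s by simp
  moreover have "r \<noteq> 0"
  proof
    assume "r = 0"
    then have "\<forall>i<n. v $ i = 0"
      by (simp add: r_def sum_nonneg_eq_0_iff)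
    then show False
      using v by (metis eq_vecI carrier_vecD index_zero_vec)
  qed
  ultimately show ?thesis
    by (simp add: Reals_cnj_iff)
qed

text \<open>\<open>W\<close> is \<open>p\<close> evaluated at \<open>A\<close>, built by Horner's
  scheme, and \<open>S\<close> is \<open>p\<close> evaluated at \<open>T\<close>. Real coefficients
  keep \<open>W\<close> Hermitian; commutation with \<open>A\<close> is carried through the
  induction because the adjoint of \<open>A * W\<close> is \<open>W * A\<close>. The same pair
  \<open>P\<close>, \<open>Q\<close> triangularises every stage, so the diagonal of \<open>S\<close>
  can be read off from that of \<open>T\<close>.\<close>

lemma hermitian_poly_calculus:
  fixes A :: "complex mat" and p :: "real poly"
  assumes A: "A \<in> carrier_mat n n" and H: "mat_adjoint A = A"
    and sim: "similar_mat_wit A T P Q" and ut: "upper_triangular T"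
  shows "\<exists>W S. W \<in> carrier_mat n n \<and> mat_adjoint W = W \<and> A * W = W * A
    \<and> similar_mat_wit W S P Q \<and> upper_triangular S
    \<and> (\<forall>i<n. S $$ (i, i) = poly (map_poly of_real p) (T $$ (i, i)))"
proof (induction p)
  case 0
  note s = similar_mat_witD2[OF A sim]
  have "similar_mat_wit (0\<^sub>m n n) (0\<^sub>m n n) P Q"
    using s by (intro similar_mat_witI[of _ _ n]) auto
  moreover have "mat_adjoint (0\<^sub>m n n) = (0\<^sub>m n n :: complex mat)"
    by (rule eq_matI) auto
  ultimately show ?case
    using A by (intro exI[of _ "0\<^sub>m n n"]) auto
next
  case (pCons c p)
  note s = similar_mat_witD2[OF A sim]
  note assoc = assoc_mult_mat[of _ n n _ n _ n]
  from pCons obtain W S where W: "W \<in> carrier_mat n n" "mat_adjoint W = W" "A * W = W * A"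
    and sim': "similar_mat_wit W S P Q" and S: "upper_triangular S"
    and diag: "\<And>i. i < n \<Longrightarrow> S $$ (i, i) = poly (map_poly of_real p) (T $$ (i, i))"
    by blast
  note s' = similar_mat_witD2[OF W(1) sim']
  define W' where "W' = of_real c \<cdot>\<^sub>m 1\<^sub>m n + A * W"
  define S' where "S' = of_real c \<cdot>\<^sub>m 1\<^sub>m n + T * S"
  have W': "W' \<in> carrier_mat n n" and S': "S' \<in> carrier_mat n n"
    using A W s s' by (auto simp: W'_def S'_def)
  have "mat_adjoint W' = W'"
    using A W by (simp add: W'_def mat_adjoint_add[of _ n n] mat_adjoint_smult mat_adjoint_mult[of _ n n _ n] H)
  moreover have "A * W' = W' * A"
  proof -
    have "A * W' = of_real c \<cdot>\<^sub>m A + A * (A * W)"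
      unfolding W'_def using A W
      by (subst mult_add_distrib_mat[of _ n n _ n]) (auto simp: mult_smult_distrib[of _ n n _ n])
    also have "A * (A * W) = A * W * A"
      using assoc[OF A W(1) A] W(3) by metis
    also have "of_real c \<cdot>\<^sub>m A + A * W * A = W' * A"
      unfolding W'_def using A W
      by (subst add_mult_distrib_mat[of _ n n _ _ n]) (auto simp: mult_smult_assoc_mat[of _ n n _ n])
    finally show ?thesis .
  qed
  moreover have "similar_mat_wit W' S' P Q"
  proof (rule similar_mat_witI[of _ _ n])
    have 1: "P * (of_real c \<cdot>\<^sub>m 1\<^sub>m n) * Q = of_real c \<cdot>\<^sub>m 1\<^sub>m n"
      using s by (simp add: mult_smult_distrib[of _ n n _ n] mult_smult_assoc_mat[of _ n n _ n])
    have "A * W = P * T * Q * (P * S * Q)"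
      using s(3) s'(3) by simp
    also have "\<dots> = P * T * (Q * P) * S * Q"
      using s(4-) s'(4-) by (simp add: assoc)
    also have "\<dots> = P * (T * S) * Q"
      using s s'(4-) by (simp add: assoc)
    finally have 2: "A * W = P * (T * S) * Q" .
    have "P * S' * Q = P * (of_real c \<cdot>\<^sub>m 1\<^sub>m n) * Q + P * (T * S) * Q"
      unfolding S'_def using s(4-) s'(4-)
      by (subst mult_add_distrib_mat[of _ n n _ n]) (auto intro!: add_mult_distrib_mat[of _ n n _ _ n])
    then show "W' = P * S' * Q"
      by (simp add: W'_def 1 2)
  qed (use s W' S' in auto)
  moreover have "upper_triangular S'"
    using upper_triangular_mult_diag(1)[OF s(5) s'(5) ut S] s s'
    by (auto simp: S'_def upper_triangular_def)
  moreover have "\<forall>i<n. S' $$ (i, i) = poly (map_poly of_real (pCons c p)) (T $$ (i, i))"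
    using upper_triangular_mult_diag(2)[OF s(5) s'(5) ut S] s s'
    using pCons.hyps by (auto simp: S'_def diag map_poly_pCons simp del: index_mult_mat(1))
  ultimately show ?case
    using W' by blast
qed

section \<open>Interpolation, and the energy as a sum over the diagonal\<close>

lemma poly_map_of_real: "poly (map_poly of_real p) (of_real x) = (of_real (poly p x) :: complex)"
  by (induction p) (simp_all add: map_poly_pCons)

text \<open>Newton's scheme: a new node \<open>a\<close> is handled by adding a multiple of
  \<open>q\<close>, which vanishes at the old nodes and not at \<open>a\<close>.\<close>

lemma poly_interpolation_exists:
  fixes g :: "'a::field \<Rightarrow> 'a"
  assumes "finite X"
  shows "\<exists>p. \<forall>x\<in>X. poly p x = g x"
  using assms
proof (induction X)
  case (insert a X)
  then obtain p where p: "\<forall>x\<in>X. poly p x = g x" by blast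
  define q where "q = (\<Prod>x\<in>X. [:- x, 1:])"
  have q: "poly q x = 0 \<longleftrightarrow> x \<in> X" for x
    using insert by (auto simp: q_def poly_prod)
  show ?case
    by (rule exI[of _ "p + Polynomial.smult ((g a - poly p a) / poly q a) q"])
      (use p q insert in \<open>auto simp: q[THEN iffD2]\<close>)
qed auto

lemma matrix_energy_upper_triangular:
  assumes A: "A \<in> carrier_mat n n" and sim: "similar_mat_wit A T P Q" and ut: "upper_triangular T"
  shows "matrix_energy A = (\<Sum>i<n. cmod (T $$ (i, i)))"
proof -
  note s = similar_mat_witD2[OF A sim]
  have "char_poly A = (\<Prod>a\<leftarrow>diag_mat T. [:- a, 1:])"
    using char_poly_similar[of A T] sim char_poly_upper_triangular[OF s(5) ut]
    unfolding similar_mat_def by auto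
  moreover have "proots (\<Prod>a\<leftarrow>as. [:- a, 1:]) = mset as" for as :: "complex list"
  proof (induction as)
    case (Cons a as)
    have "(\<Prod>a\<leftarrow>as. [:- a, 1:]) \<noteq> 0"
      by (auto simp: prod_list_zero_iff)
    then have "proots ([:- a, 1:] * (\<Prod>a\<leftarrow>as. [:- a, 1:])) = proots [:- a, 1:] + mset as"
      by (subst proots_mult) (simp_all add: Cons.IH)
    then show ?case
      by simp
  qed simp
  ultimately have "proots (char_poly A) = mset (diag_mat T)"
    by metis
  then show ?thesis
    using s(5)
    by (simp add: matrix_energy_def diag_mat_def atLeast0LessThan sum_unfold_sum_mset image_mset.compositionality comp_def)
qed

text \<open>
  \<open>W\<close> is the sign of \<open>A\<close>, with the sign of \<open>0\<close> taken to be \<open>1\<close>. It is a polynomial in \<open>A\<close>, which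
  makes it Hermitian without any spectral theorem; \<open>W\<^sup>2 - 1\<close> is then Hermitian and similar to a
  strictly triangular matrix, hence zero.
\<close>

lemma hermitian_energy_witness:
  fixes A :: "complex mat"
  assumes A: "A \<in> carrier_mat n n" and H: "mat_adjoint A = A"
  obtains W where "W \<in> carrier_mat n n" "mat_adjoint W = W" "W * W = 1\<^sub>m n"
    "mat_trace (W * A) = of_real (matrix_energy A)"
proof -
  note assoc = assoc_mult_mat[of _ n n _ n _ n]
  obtain as where as: "char_poly A = (\<Prod>a\<leftarrow>as. [:- a, 1:])"
    using char_poly_factorized[OF A] by blast
  obtain T P Q where "schur_decomposition A as = (T, P, Q)"
    by (cases "schur_decomposition A as")
  from schur_decomposition[OF A as this]
  have sim: "similar_mat_wit A T P Q" and ut: "upper_triangular T" and diagT: "diag_mat T = as"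
    by auto
  note s = similar_mat_witD2[OF A sim]
  have real: "T $$ (i, i) \<in> \<real>" if "i < n" for i
  proof (rule hermitian_eigenvalue_real[OF A H])
    have "T $$ (i, i) \<in> set as"
      using that s(5) by (auto simp flip: diagT simp: diag_mat_def)
    then show "eigenvalue A (T $$ (i, i))"
      by (auto simp: eigenvalue_root_char_poly[OF A] as poly_prod_list prod_list_zero_iff)
  qed
  \<comment> \<open>The value 1 at 0 makes the square of \<open>g\<close> identically 1, so
    \<open>W * W\<close> is the identity even when \<open>A\<close> is singular.\<close>
  define g :: "real \<Rightarrow> real" where "g x = (if x < 0 then -1 else 1)" for x
  \<comment> \<open>Interpolating at real parts yields real coefficients, as the calculus requires;
    nothing is lost because the eigenvalues are real.\<close>
  obtain p where p: "\<forall>x\<in>(\<lambda>i. Re (T $$ (i, i))) ` {..<n}. poly p x = g x"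
    using poly_interpolation_exists[of "(\<lambda>i. Re (T $$ (i, i))) ` {..<n}" g] by auto
  from hermitian_poly_calculus[OF A H sim ut, of p]
  obtain W S where W: "W \<in> carrier_mat n n" "mat_adjoint W = W"
    and simW: "similar_mat_wit W S P Q" and S: "upper_triangular S"
    and diag: "\<And>i. i < n \<Longrightarrow> S $$ (i, i) = poly (map_poly of_real p) (T $$ (i, i))"
    by blast
  note s' = similar_mat_witD2[OF W(1) simW]
  have diagS: "S $$ (i, i) = of_real (g (Re (T $$ (i, i))))" if i: "i < n" for i
  proof -
    have "T $$ (i, i) = of_real (Re (T $$ (i, i)))"
      using real[OF i] by simp
    then have "S $$ (i, i) = of_real (poly p (Re (T $$ (i, i))))"
      using diag[OF i] by (metis poly_map_of_real)
    then show ?thesis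
      using p i by simp
  qed
  define Z where "Z = W * W - 1\<^sub>m n"
  define Y where "Y = S * S - 1\<^sub>m n"
  have Z: "Z \<in> carrier_mat n n" and Y: "Y \<in> carrier_mat n n"
    using W s' by (auto simp: Z_def Y_def)
  have WW: "similar_mat_wit (W * W) (S * S) P Q"
    using similar_mat_wit_pow[OF simW, of 2] W s' by (simp add: numeral_2_eq_2)
  have simZ: "similar_mat_wit Z Y P Q"
  proof (rule similar_mat_witI[of _ _ n])
    have "P * Y * Q = P * (S * S) * Q - P * 1\<^sub>m n * Q"
      unfolding Y_def using s'(4-)
      by (subst mult_minus_distrib_mat[of _ n n _ n]) (auto intro!: minus_mult_distrib_mat[of _ n n _ _ n])
    then show "Z = P * Y * Q"
      using s'(1,6) similar_mat_witD2(3)[OF mult_carrier_mat[OF W(1) W(1)] WW] by (simp add: Z_def)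
  qed (use s' Z Y in auto)
  have utY: "upper_triangular Y"
    using upper_triangular_mult_diag(1)[OF s'(5) s'(5) S S] s'
    by (auto simp: Y_def upper_triangular_def)
  have Y0: "Y $$ (i, i) = 0" if "i < n" for i
    using upper_triangular_mult_diag(2)[OF s'(5) s'(5) S S that] s' that
    by (simp add: Y_def diagS g_def del: index_mult_mat(1))
  \<comment> \<open>\<open>Y\<close> is upper triangular with zero diagonal, hence so is
    \<open>Y * Y\<close>.\<close>
  have "mat_trace (Z * Z) = mat_trace (Y * Y)"
    using mat_trace_similar[OF similar_mat_wit_pow[OF simZ, of 2]] Z Y by (simp add: numeral_2_eq_2)
  also have "\<dots> = 0"
    using upper_triangular_mult_diag(2)[OF Y Y utY utY] Y
    by (simp add: mat_trace_def Y0 del: index_mult_mat(1))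
  finally have "mat_trace (Z * Z) = 0" .
  moreover have "mat_adjoint Z = Z"
  proof -
    have "mat_adjoint (W * W) = W * W"
      using W by (simp add: mat_adjoint_mult[of _ n n _ n])
    then have "cnj ((W * W) $$ (j, i)) = (W * W) $$ (i, j)" if "i < n" "j < n" for i j
      using that W index_mat_adjoint[of i "W * W" j] by (simp del: index_mult_mat(1))
    then show ?thesis
      using W unfolding Z_def by (intro eq_matI) (auto simp del: index_mult_mat(1))
  qed
  ultimately have Z0: "Z = 0\<^sub>m n n"
    using hermitian_trace_square_zero[OF Z] by blast
  have "W * W = 1\<^sub>m n"
  proof (rule eq_matI)
    fix i j assume "i < dim_row (1\<^sub>m n :: complex mat)" "j < dim_col (1\<^sub>m n :: complex mat)"
    then show "(W * W) $$ (i, j) = 1\<^sub>m n $$ (i, j)"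
      using arg_cong[OF Z0, of "\<lambda>M. M $$ (i, j)"] W
      by (simp add: Z_def del: index_mult_mat(1) index_one_mat(1))
  qed (use W in auto)
  moreover have "mat_trace (W * A) = of_real (matrix_energy A)"
  proof -
    have "W * A = P * S * Q * (P * T * Q)"
      using s(3) s'(3) by simp
    also have "\<dots> = P * S * (Q * P) * T * Q"
      using s(4-) s'(4-) by (simp add: assoc)
    also have "\<dots> = P * (S * T) * Q"
      using s s'(4-) by (simp add: assoc)
    finally have "similar_mat_wit (W * A) (S * T) P Q"
      using s s' W A by (intro similar_mat_witI[of _ _ n]) auto
    then have "mat_trace (W * A) = mat_trace (S * T)"
      by (rule mat_trace_similar)
    also have "\<dots> = (\<Sum>i<n. of_real (g (Re (T $$ (i, i)))) * T $$ (i, i))"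
      using upper_triangular_mult_diag(2)[OF s'(5) s(5) S ut] s'
      by (simp add: mat_trace_def diagS del: index_mult_mat(1))
    also have "\<dots> = (\<Sum>i<n. of_real (cmod (T $$ (i, i))))"
    proof (intro sum.cong refl)
      fix i assume "i \<in> {..<n}"
      then obtain t where t: "T $$ (i, i) = of_real t"
        using real[of i] by (auto elim: Reals_cases)
      show "of_real (g (Re (T $$ (i, i)))) * T $$ (i, i) = of_real (cmod (T $$ (i, i)))"
        unfolding t by (simp add: g_def)
    qed
    finally show ?thesis
      by (simp add: matrix_energy_upper_triangular[OF A sim ut])
  qed
  ultimately show ?thesis
    using that W by blast
qed


section \<open>The equality case\<close>

lemma l1_norm_trace_equality:
  fixes B V :: "complex mat"
  assumes B: "B \<in> carrier_mat n n" and V: "V \<in> carrier_mat n n"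
    and VV: "V * mat_adjoint V = 1\<^sub>m n"
    and eq: "mat_trace (V * B) = of_real (entry_l1_norm B)"
  shows "\<exists>d. B * mat_adjoint B = mat_diag n d"
proof -
  have "(\<Sum>i<n. complex_of_real ((cmod (V $$ (j, i)))\<^sup>2)) = 1" if "j < n" for j
    using arg_cong[OF VV, of "\<lambda>M. M $$ (j, j)"] that V
    by (simp add: index_mult_mat_sum[of _ n n _ n] complex_norm_square del: index_mult_mat(1) of_real_power)
  then have row: "(\<Sum>i<n. (cmod (V $$ (j, i)))\<^sup>2) = 1" if "j < n" for j
    using that unfolding of_real_sum[symmetric] of_real_eq_1_iff by blast
  have le: "cmod (V $$ (j, i)) \<le> 1" if "i < n" "j < n" for i j
  proof -
    have "(cmod (V $$ (j, i)))\<^sup>2 \<le> (\<Sum>i<n. (cmod (V $$ (j, i)))\<^sup>2)"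
      using that by (intro member_le_sum) auto
    then show ?thesis
      using row[OF that(2)] by (simp add: abs_square_le_1)
  qed
  \<comment> \<open>The swap puts the double sum in the order of \<open>entry_l1_norm\<close>, each
    entry of \<open>B\<close> being paired with the transposed entry of \<open>V\<close>.\<close>
  have "mat_trace (V * B) = (\<Sum>i<n. \<Sum>j<n. V $$ (j, i) * B $$ (i, j))"
    by (subst mat_trace_mult_eq[OF V B]) (rule sum.swap)
  then have "entry_l1_norm B = Re (\<Sum>i<n. \<Sum>j<n. V $$ (j, i) * B $$ (i, j))"
    using eq by (metis Re_complex_of_real)
  also have "\<dots> \<le> (\<Sum>i<n. \<Sum>j<n. cmod (V $$ (j, i)) * cmod (B $$ (i, j)))"
    unfolding Re_sum norm_mult[symmetric] by (intro sum_mono complex_Re_le_cmod)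
  \<comment> \<open>This sum is the slack in the bound of the trace by the entrywise norm. Its
    summands are nonnegative, so each of them is zero.\<close>
  finally have "(\<Sum>i<n. \<Sum>j<n. (1 - cmod (V $$ (j, i))) * cmod (B $$ (i, j))) \<le> 0"
    using B by (simp add: entry_l1_norm_def algebra_simps sum_subtractf)
  moreover have nonneg: "0 \<le> (1 - cmod (V $$ (j, i))) * cmod (B $$ (i, j))" if "i < n" "j < n" for i j
    using le[OF that] by simp
  ultimately have "(\<Sum>i<n. \<Sum>j<n. (1 - cmod (V $$ (j, i))) * cmod (B $$ (i, j))) = 0"
    by (intro antisym sum_nonneg) auto
  then have "(\<Sum>j<n. (1 - cmod (V $$ (j, i))) * cmod (B $$ (i, j))) = 0" if "i < n" for i
    using that by (subst (asm) sum_nonneg_eq_0_iff) (auto intro!: sum_nonneg nonneg simp del: mult_eq_0_iff)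
  then have "(1 - cmod (V $$ (j, i))) * cmod (B $$ (i, j)) = 0" if "i < n" "j < n" for i j
    using that nonneg by (metis (no_types, lifting) finite_lessThan lessThan_iff sum_nonneg_eq_0_iff)
  then have one: "cmod (V $$ (j, i)) = 1" if "i < n" "j < n" "B $$ (i, j) \<noteq> 0" for i j
    using that by fastforce
  \<comment> \<open>Two nonzero entries in column \<open>j\<close> of \<open>B\<close> would give
    row \<open>j\<close> of \<open>V\<close> two entries of modulus 1, hence squared norm at least
    2. These products are the summands of the off-diagonal entries of
    \<open>B * mat_adjoint B\<close>.\<close>
  have off: "B $$ (i, j) * cnj (B $$ (k, j)) = 0" if ik: "i \<noteq> k" "i < n" "k < n" and j: "j < n" for i j k
  proof (rule ccontr)
    assume "B $$ (i, j) * cnj (B $$ (k, j)) \<noteq> 0"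
    then have "cmod (V $$ (j, i)) = 1" "cmod (V $$ (j, k)) = 1"
      using one ik j by auto
    moreover have "(\<Sum>l\<in>{i, k}. (cmod (V $$ (j, l)))\<^sup>2) \<le> (\<Sum>l<n. (cmod (V $$ (j, l)))\<^sup>2)"
      using ik by (intro sum_mono2) auto
    ultimately show False
      using row[OF j] ik by simp
  qed
  have "B * mat_adjoint B = mat_diag n (\<lambda>i. (B * mat_adjoint B) $$ (i, i))"
    using B
    by (intro eq_matI) (auto simp: mat_diag_def index_mult_mat_sum[of _ n n _ n] off simp del: index_mult_mat(1))
  then show ?thesis
    by blast
qed

section \<open>Unitarity of the Fourier matrix\<close>

lemma fourier_matrix_carrier [simp]: "fourier_matrix N \<in> carrier_mat N N"
  by (simp add: fourier_matrix_def)

lemma dim_fourier_matrix [simp]: "dim_row (fourier_matrix N) = N" "dim_col (fourier_matrix N) = N"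
  by (simp_all add: fourier_matrix_def)

text \<open>The positive sign of the angle agrees with the enumeration of roots of unity in
  \<open>bij_betw_roots_unity\<close>, which yields injectivity; the Fourier matrix contains powers
  of the conjugate.\<close>

definition unit_root :: "nat \<Rightarrow> nat \<Rightarrow> complex" where
  "unit_root N m = cis (2 * pi * real m / real N)"

lemma unit_root_norm [simp]: "cnj (unit_root N m) * unit_root N m = 1"
  by (simp add: unit_root_def cis_cnj cis_mult)

lemma unit_root_power: "N > 0 \<Longrightarrow> unit_root N m ^ N = 1"
  using cis_multiple_2pi[of "real m"] by (simp add: unit_root_def DeMoivre)

lemma unit_root_inj: "m < N \<Longrightarrow> k < N \<Longrightarrow> unit_root N m = unit_root N k \<longleftrightarrow> m = k"
  using inj_on_eq_iff[OF bij_betw_imp_inj_on[OF bij_betw_roots_unity[of N]], of m k]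
  by (simp add: unit_root_def)

lemma index_fourier_matrix:
  assumes "m < N" "x < N"
  shows "fourier_matrix N $$ (m, x) = of_real (1 / sqrt (real N)) * cnj (unit_root N m) ^ x"
proof -
  have "exp (- 2 * complex_of_real pi * \<i> * of_nat m * of_nat x / of_nat N)
      = cis (real x * (- (2 * pi * real m / real N)))"
    by (simp add: cis_conv_exp algebra_simps)
  then show ?thesis
    using assms by (simp add: fourier_matrix_def unit_root_def cis_cnj DeMoivre)
qed

text \<open>The inner product of rows \<open>m\<close> and \<open>k\<close> is a geometric sum whose
  ratio \<open>z\<close> is an \<open>N\<close>-th root of unity. The sum vanishes unless
  \<open>z = 1\<close>, that is, unless \<open>m = k\<close>.\<close>

lemma fourier_matrix_unitary: "fourier_matrix N * mat_adjoint (fourier_matrix N) = 1\<^sub>m N"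
proof (rule eq_matI)
  fix m k assume "m < dim_row (1\<^sub>m N :: complex mat)" "k < dim_col (1\<^sub>m N :: complex mat)"
  then have mk: "m < N" "k < N" and N: "N > 0" by auto
  define z where "z = cnj (unit_root N m) * unit_root N k"
  have "(fourier_matrix N * mat_adjoint (fourier_matrix N)) $$ (m, k)
      = (\<Sum>x<N. fourier_matrix N $$ (m, x) * cnj (fourier_matrix N $$ (k, x)))"
    using mk by (simp add: index_mult_mat_sum[of _ N N _ N] del: index_mult_mat(1))
  also have "\<dots> = (\<Sum>x<N. of_real (1 / real N) * z ^ x)"
  proof (intro sum.cong refl)
    fix x assume "x \<in> {..<N}"
    moreover have "complex_of_real (sqrt (real N)) * complex_of_real (sqrt (real N)) = of_nat N"
      by (simp flip: of_real_mult)
    ultimately show "fourier_matrix N $$ (m, x) * cnj (fourier_matrix N $$ (k, x))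
        = of_real (1 / real N) * z ^ x"
      using mk by (simp add: index_fourier_matrix z_def power_mult_distrib)
  qed
  also have "\<dots> = of_real (1 / real N) * (\<Sum>x<N. z ^ x)"
    by (simp only: sum_distrib_left)
  also have "\<dots> = (if m = k then 1 else 0)"
  proof (cases "m = k")
    case True
    then show ?thesis using N by (simp add: z_def)
  next
    case False
    have "unit_root N m * z = unit_root N k"
      unfolding z_def using unit_root_norm[of N m] by (metis mult.assoc mult.commute mult_1)
    then have "z \<noteq> 1"
      using False unit_root_inj[OF mk] by auto
    moreover have "z ^ N = 1"
      using N unit_root_power[OF N] by (simp add: z_def power_mult_distrib flip: complex_cnj_power)
    ultimately show ?thesis
      using False by (simp add: geometric_sum)
  qed
  finally show "(fourier_matrix N * mat_adjoint (fourier_matrix N)) $$ (m, k) = 1\<^sub>m N $$ (m, k)"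
    using mk by simp
qed auto

lemma fourier_matrix_unitary': "mat_adjoint (fourier_matrix N) * fourier_matrix N = 1\<^sub>m N"
  by (rule mat_mult_left_right_inverse[OF _ _ fourier_matrix_unitary]) auto

section \<open>Hermitian matrices under the Fourier transform\<close>

lemma similar_mat_wit_fourier:
  assumes "M \<in> carrier_mat N N"
  shows "similar_mat_wit (fourier_matrix N * M * mat_adjoint (fourier_matrix N)) M
      (fourier_matrix N) (mat_adjoint (fourier_matrix N))"
proof -
  have F': "mat_adjoint (fourier_matrix N) \<in> carrier_mat N N"
    by simp
  show ?thesis
    by (rule similar_mat_witI[OF fourier_matrix_unitary fourier_matrix_unitary' refl
          mult_carrier_mat[OF mult_carrier_mat[OF fourier_matrix_carrier assms] F'] assms
          fourier_matrix_carrier F'])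
qed

lemma fourier_conj_cancel:
  assumes "M \<in> carrier_mat N N" "D = fourier_matrix N * M * mat_adjoint (fourier_matrix N)"
  shows "M = mat_adjoint (fourier_matrix N) * D * fourier_matrix N"
  using similar_mat_wit_sym[OF similar_mat_wit_fourier[OF assms(1)]]
  unfolding assms(2) similar_mat_wit_def Let_def by blast

text \<open>With \<open>F\<close> on both sides, \<open>F * A * F\<close> need not be similar to
  \<open>A\<close>. Multiplying by its adjoint cancels the right factor and leaves a genuine
  conjugate of \<open>A * A\<close>. This is why the argument reaches even powers only.\<close>

lemma fourier_transform_mult_adjoint:
  assumes A: "A \<in> carrier_mat N N" and H: "mat_adjoint A = A"
  defines "F \<equiv> fourier_matrix N"
  shows "F * A * F * mat_adjoint (F * A * F) = F * (A * A) * mat_adjoint F"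
proof -
  note assoc = assoc_mult_mat[of _ N N _ N _ N]
  define F' where "F' = mat_adjoint F"
  have F: "F \<in> carrier_mat N N" and F': "F' \<in> carrier_mat N N" and FF': "F * F' = 1\<^sub>m N"
    by (simp_all add: F'_def F_def fourier_matrix_unitary)
  have "mat_adjoint (F * A * F) = F' * (A * F')"
    using A F F' by (simp add: mat_adjoint_mult[of _ N N _ N] H assoc flip: F'_def)
  then have "F * A * F * mat_adjoint (F * A * F) = F * A * (F * F') * (A * F')"
    using A F F' by (simp add: assoc)
  also have "\<dots> = F * (A * A) * F'"
    using A F F' by (simp add: FF' assoc)
  finally show ?thesis
    by (simp add: F'_def)
qed

lemma frobenius_norm_fourier:
  assumes A: "A \<in> carrier_mat N N" and H: "mat_adjoint A = A"
  shows "frobenius_norm (fourier_matrix N * A * fourier_matrix N) = frobenius_norm A"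
  using mat_trace_similar[OF similar_mat_wit_fourier[of "A * A" N]] A
  by (simp add: frobenius_norm_eq_trace fourier_transform_mult_adjoint[OF A H] H)

lemma l1_norm_fourier_eq_energy:
  fixes A :: "complex mat"
  assumes A: "A \<in> carrier_mat N N" and H: "mat_adjoint A = A"
    and eq: "entry_l1_norm (fourier_matrix N * A * fourier_matrix N) = matrix_energy A"
  shows "\<exists>d. A * A = mat_adjoint (fourier_matrix N) * mat_diag N d * fourier_matrix N"
proof -
  note assoc = assoc_mult_mat[of _ N N _ N _ N]
  define F where "F = fourier_matrix N"
  define F' where "F' = mat_adjoint F"
  have F: "F \<in> carrier_mat N N" and F': "F' \<in> carrier_mat N N" and adj: "mat_adjoint F' = F"
    and FF': "F * F' = 1\<^sub>m N" and F'F: "F' * F = 1\<^sub>m N"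
    by (simp_all add: F'_def F_def fourier_matrix_unitary fourier_matrix_unitary')
  obtain W where W: "W \<in> carrier_mat N N" "mat_adjoint W = W" "W * W = 1\<^sub>m N"
    "mat_trace (W * A) = of_real (matrix_energy A)"
    using hermitian_energy_witness[OF A H] .
  define V where "V = F' * W * F'"
  have V: "V \<in> carrier_mat N N"
    using F' W(1) by (simp add: V_def)
  have "mat_adjoint V = F * (W * F)"
    using F F' W(1,2) by (simp add: V_def mat_adjoint_mult[of _ N N _ N] adj assoc)
  then have "V * mat_adjoint V = F' * W * (F' * F) * (W * F)"
    using F F' W(1) by (simp add: V_def assoc)
  also have "\<dots> = F' * (W * W) * F"
    using F F' W(1) by (simp add: F'F assoc)
  also have "\<dots> = 1\<^sub>m N"
    using F' by (simp add: W(3) F'F)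
  finally have VV: "V * mat_adjoint V = 1\<^sub>m N" .
  \<comment> \<open>\<open>V\<close> carries \<open>F'\<close> on both sides so that this product
    collapses to a conjugate of \<open>W * A\<close>, whose trace is the energy.\<close>
  have "V * (F * A * F) = F' * W * (F' * F) * (A * F)"
    using F F' W(1) A by (simp add: V_def assoc)
  also have "\<dots> = F' * (W * A) * F"
    using F F' W(1) A by (simp add: F'F assoc)
  finally have "similar_mat_wit (V * (F * A * F)) (W * A) F' F"
    using F F' V W(1) A FF' F'F by (intro similar_mat_witI[of _ _ N]) auto
  then have "mat_trace (V * (F * A * F)) = of_real (entry_l1_norm (F * A * F))"
    using W(4) eq by (simp add: mat_trace_similar F_def)
  then obtain d where "F * A * F * mat_adjoint (F * A * F) = mat_diag N d"
    using l1_norm_trace_equality[OF _ V VV, of "F * A * F"] F A by auto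
  then have "mat_diag N d = F * (A * A) * mat_adjoint F"
    using fourier_transform_mult_adjoint[OF A H] by (simp add: F_def)
  then have "A * A = mat_adjoint F * mat_diag N d * F"
    using fourier_conj_cancel[of "A * A" N] A by (simp add: F_def)
  then show ?thesis
    unfolding F_def by blast
qed

section \<open>Circulant powers\<close>

lemma mat_diag_pow: "mat_diag n d ^\<^sub>m q = mat_diag n (\<lambda>i. d i ^ q)"
proof (induction q)
  case 0
  show ?case
    using carrier_matD(1)[OF mat_diag_dim[of n d]] by simp
next
  case (Suc q)
  then show ?case
    by (simp add: power_commutes)
qed

text \<open>Shifting both indices by one multiplies the \<open>m\<close>-th summand by a phase and
  by its conjugate, which cancel.\<close>

lemma fourier_diag_circulant:
  fixes d :: "nat \<Rightarrow> complex"
  assumes xy: "x < N" "y < N"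
  defines "M \<equiv> mat_adjoint (fourier_matrix N) * mat_diag N d * fourier_matrix N"
  shows "M $$ ((x + 1) mod N, (y + 1) mod N) = M $$ (x, y)"
proof -
  define F where "F = fourier_matrix N"
  have N: "N > 0" using xy by simp
  have entry: "M $$ (x, y) = (\<Sum>m<N. cnj (F $$ (m, x)) * d m * F $$ (m, y))"
    if "x < N" "y < N" for x y
    using that unfolding M_def F_def
    by (subst index_mult_mat_sum[of _ N N _ N], simp_all add: mat_diag_mult_right[of _ N N] del: index_mult_mat(1))
  have shift: "F $$ (m, (x + 1) mod N) = cnj (unit_root N m) * F $$ (m, x)" if "m < N" "x < N" for m x
  proof -
    have "cnj (unit_root N m) ^ N = 1"
      using unit_root_power[OF N] by (simp flip: complex_cnj_power)
    \<comment> \<open>The wrap-around from \<open>N - 1\<close> to \<open>0\<close> is harmless,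
      since the \<open>N\<close>-th power of the root is 1.\<close>
    then have "cnj (unit_root N m) ^ ((x + 1) mod N) = cnj (unit_root N m) ^ (x + 1)"
      by (metis mult_div_mod_eq power_add power_mult power_one mult_1)
    then show ?thesis
      using that N by (simp add: F_def index_fourier_matrix)
  qed
  have "cnj (F $$ (m, (x + 1) mod N)) * d m * F $$ (m, (y + 1) mod N)
      = (cnj (unit_root N m) * unit_root N m) * (cnj (F $$ (m, x)) * d m * F $$ (m, y))"
    if "m < N" for m
    unfolding shift[OF that xy(1)] shift[OF that xy(2)] by (simp only: complex_cnj_mult complex_cnj_cnj mult_ac)
  then have "cnj (F $$ (m, (x + 1) mod N)) * d m * F $$ (m, (y + 1) mod N)
      = cnj (F $$ (m, x)) * d m * F $$ (m, y)" if "m < N" for m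
    using that by (simp only: unit_root_norm mult_1)
  then have "(\<Sum>m<N. cnj (F $$ (m, (x + 1) mod N)) * d m * F $$ (m, (y + 1) mod N))
      = (\<Sum>m<N. cnj (F $$ (m, x)) * d m * F $$ (m, y))"
    by (intro sum.cong refl) simp
  then show ?thesis
    using N xy by (simp only: entry mod_less_divisor)
qed

lemma even_power_circulant:
  fixes A :: "complex mat"
  assumes A: "A \<in> carrier_mat N N" and H: "mat_adjoint A = A"
    and eq: "entry_l1_norm (fourier_matrix N * A * fourier_matrix N) = matrix_energy A"
    and xy: "x < N" "y < N"
  shows "(A ^\<^sub>m (2 * q)) $$ ((x + 1) mod N, (y + 1) mod N) = (A ^\<^sub>m (2 * q)) $$ (x, y)"
proof -
  obtain d where d: "A * A = mat_adjoint (fourier_matrix N) * mat_diag N d * fourier_matrix N"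
    using l1_norm_fourier_eq_energy[OF A H eq] by blast
  have "similar_mat_wit (A * A) (mat_diag N d) (mat_adjoint (fourier_matrix N)) (fourier_matrix N)"
    using A d
    by (intro similar_mat_witI[OF fourier_matrix_unitary' fourier_matrix_unitary d]) auto
  then have "(A * A) ^\<^sub>m q = mat_adjoint (fourier_matrix N) * mat_diag N (\<lambda>i. d i ^ q) * fourier_matrix N"
    by (simp add: similar_mat_wit_pow_id mat_diag_pow)
  moreover have "A ^\<^sub>m (2 * q) = (A * A) ^\<^sub>m q"
    using A by (induction q) (auto simp: assoc_mult_mat[of _ N N _ N _ N])
  ultimately show ?thesis
    using fourier_diag_circulant[OF xy] by simp
qed


section \<open>Adjacency matrices and walks\<close>

lemma adj_matrix_carrier [simp]: "adj_matrix G \<sigma> \<in> carrier_mat (graph_order G) (graph_order G)"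
  by (simp add: adj_matrix_def)

lemma dim_adj_matrix [simp]:
  "dim_row (adj_matrix G \<sigma>) = graph_order G" "dim_col (adj_matrix G \<sigma>) = graph_order G"
  by (simp_all add: adj_matrix_def)

lemma adj_matrix_hermitian:
  assumes "pair_graph G"
  shows "mat_adjoint (adj_matrix G \<sigma>) = adj_matrix G \<sigma>"
proof -
  interpret pair_graph G by fact
  show ?thesis
    by (rule eq_matI) (auto simp: adj_matrix_def dest: arcs_symmetric)
qed

lemma label_vertex_bij:
  assumes "vertex_labeling G \<sigma>"
  shows "bij_betw (label_vertex G \<sigma>) {..<graph_order G} (pverts G)"
  using bij_betw_inv_into[OF assms[unfolded vertex_labeling_def]]
  by (simp add: label_vertex_def[abs_def])

text \<open>The map from arcs to edges has fibres \<open>{(u, v), (v, u)}\<close>; absence of loops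
  makes the two arcs distinct.\<close>

lemma card_arcs_eq:
  assumes "pair_graph G"
  shows "card (parcs G) = 2 * graph_size G"
proof -
  interpret pair_graph G by fact
  let ?h = "\<lambda>(u, v). {u, v}"
  have E: "{{u, v} |u v. (u, v) \<in> parcs G} = ?h ` parcs G"
    by force
  have "card {p \<in> parcs G. ?h p = e} = 2" if "e \<in> ?h ` parcs G" for e
  proof -
    obtain u v where uv: "(u, v) \<in> parcs G" "e = {u, v}"
      using \<open>e \<in> ?h ` parcs G\<close> by force
    then have "{p \<in> parcs G. ?h p = e} = {(u, v), (v, u)}"
      using arcs_symmetric by (auto simp: doubleton_eq_iff)
    then show ?thesis
      using no_loops'[OF uv(1)] by simp
  qed
  then have "(\<Sum>e\<in>?h ` parcs G. card {p \<in> parcs G. ?h p = e}) = 2 * graph_size G"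
    by (simp add: graph_size_def E)
  moreover have "card (parcs G) = (\<Sum>e\<in>?h ` parcs G. card {p \<in> parcs G. ?h p = e})"
    using sum.image_gen[OF pair_finite_arcs, of "\<lambda>_. 1::nat" ?h] by simp
  ultimately show ?thesis by simp
qed

text \<open>The entries are 0 or 1, so the sum of squares counts arcs after reindexing from labels
  to vertices.\<close>

lemma frobenius_norm_adj_matrix:
  assumes G: "pair_graph G" and \<sigma>: "vertex_labeling G \<sigma>"
  shows "frobenius_norm (adj_matrix G \<sigma>) = sqrt (2 * real (graph_size G))"
proof -
  interpret pair_graph G by fact
  let ?N = "graph_order G" and ?l = "label_vertex G \<sigma>"
  have bij: "bij_betw (map_prod ?l ?l) ({..<?N} \<times> {..<?N}) (pverts G \<times> pverts G)"
    using label_vertex_bij[OF \<sigma>] by (intro bij_betw_map_prod)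
  have "(\<Sum>i<?N. \<Sum>j<?N. (cmod (adj_matrix G \<sigma> $$ (i, j)))\<^sup>2)
      = (\<Sum>p\<in>{..<?N} \<times> {..<?N}. if map_prod ?l ?l p \<in> parcs G then 1 else 0 :: real)"
    unfolding sum.cartesian_product by (intro sum.cong) (auto simp: adj_matrix_def)
  also have "\<dots> = (\<Sum>p\<in>pverts G \<times> pverts G. if p \<in> parcs G then 1 else 0)"
    by (rule sum.reindex_bij_betw[OF bij])
  also have "\<dots> = (\<Sum>p\<in>parcs G. 1)"
    using pair_finite_verts wellformed' by (intro sum.mono_neutral_cong_right) auto
  finally show ?thesis
    by (simp add: frobenius_norm_def adj_matrix_def card_arcs_eq[OF G])
qed

lemma fourier_ratio_adj_matrix:
  assumes "pair_graph G" "vertex_labeling G \<sigma>"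
  shows "fourier_ratio (adj_matrix G \<sigma>)
    = entry_l1_norm (fourier_matrix (graph_order G) * adj_matrix G \<sigma> * fourier_matrix (graph_order G))
      / sqrt (2 * real (graph_size G))"
  using frobenius_norm_fourier[OF adj_matrix_carrier adj_matrix_hermitian[OF assms(1), of \<sigma>]]
    frobenius_norm_adj_matrix[OF assms]
  by (simp add: fourier_ratio_def Let_def)

text \<open>Matrix powers unfold on the right, whereas walks are split at their first arc.\<close>

lemma pow_mat_Suc_left:
  fixes A :: "'a::semiring_1 mat"
  assumes "A \<in> carrier_mat n n"
  shows "A ^\<^sub>m Suc k = A * A ^\<^sub>m k"
proof (induction k)
  case (Suc k)
  then show ?case
    using assms assoc_mult_mat[of A n n "A ^\<^sub>m k" n A n] by simp
qed (use assms in simp)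

lemma adj_matrix_pow_walk_count:
  assumes G: "pair_graph G" and \<sigma>: "vertex_labeling G \<sigma>"
    and "x < graph_order G" "y < graph_order G"
  shows "(adj_matrix G \<sigma> ^\<^sub>m l) $$ (x, y) = of_nat (walk_count G \<sigma> l x y)"
  using assms(3)
proof (induction l arbitrary: x)
  interpret pair_graph G by fact
  let ?l = "label_vertex G \<sigma>"
  have inj: "?l i = ?l j \<longleftrightarrow> i = j" if "i < graph_order G" "j < graph_order G" for i j
    using label_vertex_bij[OF \<sigma>] that by (auto simp: bij_betw_def inj_on_eq_iff)
  have verts: "?l i \<in> pverts G" if "i < graph_order G" for i
    using label_vertex_bij[OF \<sigma>] that by (auto simp: bij_betw_def)
  case 0
  \<comment> \<open>An empty walk exists only at a vertex of the graph, hence the appeal to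
    \<open>verts\<close>; injectivity of the labels then gives the identity matrix.\<close>
  have "{p. awalk (?l x) p (?l y) \<and> length p = 0} = (if x = y then {[]} else {})"
    using 0 assms(4) by (auto simp: awalk_Nil_iff inj verts)
  then show ?case
    using 0 assms(4) by (simp add: walk_count_def)
next
  interpret pair_graph G by fact
  let ?N = "graph_order G" and ?l = "label_vertex G \<sigma>" and ?A = "adj_matrix G \<sigma>"
  case (Suc k)
  define X where "X z = {p. awalk (?l z) p (?l y) \<and> length p = k}" for z
  have surj: "\<exists>z<?N. v = ?l z" if "v \<in> pverts G" for v
    using label_vertex_bij[OF \<sigma>] that by (auto simp: bij_betw_def)
  have inj: "?l i = ?l j \<longleftrightarrow> i = j" if "i < ?N" "j < ?N" for i j
    using label_vertex_bij[OF \<sigma>] that by (auto simp: bij_betw_def inj_on_eq_iff)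
  have fin: "finite (X z)" for z
    by (rule finite_subset[OF _ finite_lists_length_eq[OF pair_finite_arcs, of k]])
      (auto simp: X_def awalk_def)
  \<comment> \<open>\<open>Z\<close> holds the labels of the neighbours. A walk of length
    \<open>k + 1\<close> is an arc to one of them followed by a walk of length \<open>k\<close>;
    distinct labels give distinct first arcs, so the union is disjoint.\<close>
  define Z where "Z = {z. z < ?N \<and> (?l x, ?l z) \<in> parcs G}"
  have "{p. awalk (?l x) p (?l y) \<and> length p = Suc k} = (\<Union>z\<in>Z. (#) (?l x, ?l z) ` X z)"
  proof (intro equalityI subsetI)
    fix p assume "p \<in> {p. awalk (?l x) p (?l y) \<and> length p = Suc k}"
    then obtain e es where p: "p = e # es" "e \<in> parcs G" "?l x = fst e" "awalk (snd e) es (?l y)" "length es = k"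
      by (cases p) (auto simp: awalk_Cons_iff)
    moreover obtain z where "z < ?N" "snd e = ?l z"
      using surj arc_snd_in_verts[OF p(2)] by blast
    ultimately show "p \<in> (\<Union>z\<in>Z. (#) (?l x, ?l z) ` X z)"
      by (cases e) (auto simp: Z_def X_def)
  qed (auto simp: Z_def X_def awalk_Cons_iff)
  then have "walk_count G \<sigma> (Suc k) x y = card (\<Union>z\<in>Z. (#) (?l x, ?l z) ` X z)"
    by (simp add: walk_count_def)
  also have "\<dots> = (\<Sum>z\<in>Z. card ((#) (?l x, ?l z) ` X z))"
    by (rule card_UN_disjoint) (auto simp: Z_def fin inj)
  also have "\<dots> = (\<Sum>z\<in>Z. walk_count G \<sigma> k z y)"
    by (intro sum.cong refl) (simp add: card_image walk_count_def X_def)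
  finally have *: "walk_count G \<sigma> (Suc k) x y = (\<Sum>z\<in>Z. walk_count G \<sigma> k z y)" .
  have "(?A ^\<^sub>m Suc k) $$ (x, y) = (\<Sum>z<?N. ?A $$ (x, z) * (?A ^\<^sub>m k) $$ (z, y))"
    unfolding pow_mat_Suc_left[OF adj_matrix_carrier]
    using Suc.prems assms(4) by (intro index_mult_mat_sum) auto
  also have "\<dots> = (\<Sum>z<?N. if (?l x, ?l z) \<in> parcs G then of_nat (walk_count G \<sigma> k z y) else 0)"
    using Suc.prems by (intro sum.cong refl) (auto simp: Suc.IH, auto simp: adj_matrix_def)
  also have "\<dots> = (\<Sum>z\<in>Z. of_nat (walk_count G \<sigma> k z y))"
    unfolding Z_def by (intro sum.mono_neutral_cong_right) auto
  finally show ?case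
    by (simp add: *)
qed

theorem corollary2p10:
  fixes G :: "'a pair_pre_digraph" and \<sigma> :: "'a \<Rightarrow> nat"
  assumes "pair_graph G"
    and "graph_size G > 0"
    and "edge_complexity G = graph_energy G / sqrt (2 * real (graph_size G))"
    and "vertex_labeling G \<sigma>"
    and "fourier_ratio (adj_matrix G \<sigma>) = graph_energy G / sqrt (2 * real (graph_size G))"
  shows "\<forall>q::nat. q > 0 \<longrightarrow> walk_circulant_at G \<sigma> (2 * q)"
proof (intro allI impI)
  fix q :: nat
  let ?N = "graph_order G" and ?A = "adj_matrix G \<sigma>"
  \<comment> \<open>The positive size allows the common denominator to be cancelled, and the
    labeling chosen inside \<open>graph_energy\<close> is exchanged for the given one.\<close>
  have eq: "entry_l1_norm (fourier_matrix ?N * ?A * fourier_matrix ?N) = matrix_energy ?A"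
    using assms(2,5) fourier_ratio_adj_matrix[OF assms(1,4)] graph_energy_eq[OF assms(4)] by simp
  \<comment> \<open>Walk counts are compared as complex matrix entries; injectivity of
    \<open>of_nat\<close> brings the equality back to natural numbers.\<close>
  have "complex_of_nat (walk_count G \<sigma> (2 * q) x y)
      = of_nat (walk_count G \<sigma> (2 * q) ((x + 1) mod ?N) ((y + 1) mod ?N))"
    if "x < ?N" "y < ?N" for x y
    using even_power_circulant[OF adj_matrix_carrier adj_matrix_hermitian[OF assms(1)] eq that, of q] that
    by (simp add: adj_matrix_pow_walk_count[OF assms(1,4)])
  then show "walk_circulant_at G \<sigma> (2 * q)"
    unfolding walk_circulant_at_def Let_def of_nat_eq_iff by blast
qed

end
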